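(* Let $(P,\leq,{}',0,1)$ be a bounded strict Kleene poset satisfying $L(x,y)\neq\{0\}$ for all $x,y\in P\setminus\{0\}$. Define mappings $\odot,\rightarrow$ from $P^2$ to $2^P$ by \[ x\odot y:=\begin{cases}\{0\}&\text{if }x\leq y',\\ L(x,y)&\text{otherwise,}\end{cases}\qquad x\rightarrow y:=\begin{cases}\{1\}&\text{if }x\leq y,\\ U(x',y)&\text{otherwise.}\end{cases} \] Then $(P,\leq,\odot,\rightarrow,0,1)$ is a Kleene residuated poset.
   Context: Let $(P,\leq)$ be a poset. For $A,B\subseteq P$ write $A\leq B$ if $x\leq y$ for all $x\in A$, $y\in B$; for an element $a$, $a\leq B$ means $\{a\}\leq B$ and $A\leq a$ means $A\leq\{a\}$. Put $L(A)=\{x\in P\mid x\leq A\}$ and $U(A)=\{x\in P\mid A\leq x\}$. Write $L(a)=L(\{a\})$, $L(a,b)=L(\{a,b\})$, $L(A,b)=L(A\cup\{b\})$, $L(A,B)=L(A\cup B)$, $LU(A)=L(U(A))$, and analogously for $U$. A poset is bounded if it has a least element $0$ and a greatest element $1$. A unary operation $'$ on $P$ is antitone if $x\leq y$ implies $y'\leq x'$, and an involution if $x''=x$ for all $x$. A poset is distributive if $L(U(x,y),z)=LU(L(x,z),L(y,z))$ for all elements $x,y,z$. A strict pseudo-Kleene poset is a bounded poset $(P,\leq,{}')$ with an antitone involution such that $L(x,x')=L(y,y')$ for all $x,y\in P\setminus\{0,1\}$. A strict Kleene poset is a distributive strict pseudo-Kleene poset. A mapping $\odot:P^2\to2^P$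 is extended to $(2^P)^2$ by $A\odot B:=\bigcap_{x\in A,\,y\in B}(x\odot y)$ for $A,B\subseteq P$; singletons are identified with their unique element, so that $A\odot z$ means $A\odot\{z\}$ and $x\odot B$ means $\{x\}\odot B$. A Kleene residuated poset is an ordered six-tuple $(P,\leq,\odot,\rightarrow,0,1)$ where $(P,\leq,0,1)$ (with its antitone involution $'$) is a bounded strict pseudo-Kleene poset and $\odot$ and $\rightarrow$ are mappings from $P^2$ to $2^P$ satisfying for all $x,y,z\in P$: - $x\odot y=y\odot x$, - $x\odot1=1\odot x=L(x)$, - $(x\odot y)\odot z=x\odot(y\odot z)$, - $x\odot y\leq z$ if and only if $x\leq y\rightarrow z$ (adjointness). *)

theory Defs
  imports "HOL-Library.Lub_Glb"
begin

text \<open>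
  The poset is the whole type; boundedness is the sort \<open>{order_bot, order_top}\<close>, with
  \<open>bot\<close> for \<open>0\<close> and \<open>top\<close> for \<open>1\<close> (the two may coincide). For an element \<open>a\<close> and a set \<open>B\<close>,
  the relations \<open>a \<le> B\<close> and \<open>B \<le> a\<close> are the library's \<open>a <=* B\<close> and \<open>B *<= a\<close>.
\<close>

abbreviation Lower_cone :: "'a::order set \<Rightarrow> 'a set" where
  "Lower_cone A \<equiv> lbs UNIV A"

abbreviation Upper_cone :: "'a::order set \<Rightarrow> 'a set" where
  "Upper_cone A \<equiv> ubs UNIV A"

definition distributive_poset :: "'a::order itself \<Rightarrow> bool" where
  "distributive_poset (_ :: 'a itself) \<longleftrightarrow>
     (\<forall>x y z :: 'a. Lower_cone (Upper_cone {x, y} \<union> {z}) =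
        Lower_cone (Upper_cone (Lower_cone {x, z} \<union> Lower_cone {y, z})))"

locale strict_pseudo_Kleene_poset =
  fixes compl :: "'a::{order_bot, order_top} \<Rightarrow> 'a"
  assumes compl_antitone: "antimono compl"
    and compl_involution: "compl (compl x) = x"
    and strict: "x \<in> UNIV - {bot, top} \<Longrightarrow> y \<in> UNIV - {bot, top} \<Longrightarrow>
      Lower_cone {x, compl x} = Lower_cone {y, compl y}"

locale strict_Kleene_poset = strict_pseudo_Kleene_poset compl
  for compl :: "'a::{order_bot, order_top} \<Rightarrow> 'a" +
  assumes distributive: "distributive_poset TYPE('a)"

text \<open>
  The extension of \<open>\<odot>\<close> to subsets is an intersection, not a union; it yields \<open>UNIV\<close> if one
  of the arguments is empty.
\<close>

definition set_extension :: "('a \<Rightarrow> 'a \<Rightarrow> 'a set) \<Rightarrow> 'a set \<Rightarrow> 'a set \<Rightarrow> 'a set" where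
  "set_extension odot A B = (\<Inter>x\<in>A. \<Inter>y\<in>B. odot x y)"

locale Kleene_residuated_poset = strict_pseudo_Kleene_poset compl
  for compl :: "'a::{order_bot, order_top} \<Rightarrow> 'a" +
  fixes odot :: "'a \<Rightarrow> 'a \<Rightarrow> 'a set"
    and arrow :: "'a \<Rightarrow> 'a \<Rightarrow> 'a set"
  assumes odot_commute: "odot x y = odot y x"
    and odot_top: "odot x top = Lower_cone {x}"
    and top_odot: "odot top x = Lower_cone {x}"
    and odot_assoc: "set_extension odot (odot x y) {z} = set_extension odot {x} (odot y z)"
    and adjointness: "odot x y *<= z \<longleftrightarrow> x <=* arrow y z"

definition Kleene_odot ::
    "('a::{order_bot, order_top} \<Rightarrow> 'a) \<Rightarrow> 'a \<Rightarrow> 'a \<Rightarrow> 'a set" where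
  "Kleene_odot compl x y = (if x \<le> compl y then {bot} else Lower_cone {x, y})"

definition Kleene_arrow ::
    "('a::{order_bot, order_top} \<Rightarrow> 'a) \<Rightarrow> 'a \<Rightarrow> 'a \<Rightarrow> 'a set" where
  "Kleene_arrow compl x y = (if x \<le> y then {top} else Upper_cone {compl x, y})"

end

theory Submission
  imports Defs
begin

text \<open>
  Associativity is forced by the least element. Every product contains \<open>bot\<close>, and
  \<open>bot\<close> multiplied by anything is \<open>{bot}\<close>; as products of subsets are intersections,
  both bracketings of a triple product collapse to \<open>{bot}\<close>.

  Adjointness is the substantial axiom. The two case distinctions in the definitions are
  harmless: if \<open>x \<le> compl y\<close> or \<open>y \<le> z\<close>, both sides hold. In the remaining case one has to
  show that \<open>L(x, y)\<close> lies below \<open>z\<close> iff \<open>x\<close> lies below \<open>U(compl y, z)\<close>, which is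
  the residuation law of a Boolean algebra. The Boolean proof
  uses distributivity and two complement laws, ``the meet of \<open>y\<close> and \<open>compl y\<close> is below
  everything'' and ``their join is above everything''. Strictness supplies the first law for
  every element except \<open>bot\<close> and the second for every element except \<open>top\<close>
  (lemmas \<open>below_compl_pair_le\<close> and \<open>le_above_compl_pair\<close>). In each
  direction, the side that is assumed, together with \<open>\<not> x \<le> compl y\<close> and
  \<open>\<not> y \<le> z\<close>, rules out the exceptional element.
\<close>

lemma mem_Lower_cone: "w \<in> Lower_cone A \<longleftrightarrow> (\<forall>a\<in>A. w \<le> a)"
  by (simp add: lbs_def isLb_def setge_def)

lemma mem_Upper_cone: "w \<in> Upper_cone A \<longleftrightarrow> (\<forall>a\<in>A. a \<le> w)"
  by (simp add: ubs_def isUb_def setle_def)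

text \<open>
  The inclusion of the distributive law that does not hold in every poset, with the cones
  unfolded: an element below \<open>U(x, y)\<close> and below \<open>z\<close> is below each common upper
  bound \<open>u\<close> of \<open>L(x, z)\<close> and \<open>L(y, z)\<close>.
\<close>

lemma distributive_poset_le:
  fixes x y z w u :: "'a::order"
  assumes "distributive_poset TYPE('a)"
    and "\<And>v. x \<le> v \<Longrightarrow> y \<le> v \<Longrightarrow> w \<le> v" and "w \<le> z"
    and "\<And>v. v \<le> x \<Longrightarrow> v \<le> z \<Longrightarrow> v \<le> u" and "\<And>v. v \<le> y \<Longrightarrow> v \<le> z \<Longrightarrow> v \<le> u"
  shows "w \<le> u"
proof -
  have "w \<in> Lower_cone (Upper_cone {x, y} \<union> {z})"
    using assms(2,3) by (auto simp: mem_Lower_cone mem_Upper_cone)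
  then have "w \<in> Lower_cone (Upper_cone (Lower_cone {x, z} \<union> Lower_cone {y, z}))"
    using assms(1) unfolding distributive_poset_def by blast
  moreover have "u \<in> Upper_cone (Lower_cone {x, z} \<union> Lower_cone {y, z})"
    using assms(4,5) by (auto simp: mem_Lower_cone mem_Upper_cone)
  ultimately show ?thesis
    by (simp only: mem_Lower_cone)
qed

context strict_pseudo_Kleene_poset
begin

lemma compl_le_compl: "x \<le> y \<Longrightarrow> compl y \<le> compl x"
  using compl_antitone by (rule antimonoD)

lemma le_compl_commute: "x \<le> compl y \<longleftrightarrow> y \<le> compl x"
  using compl_le_compl compl_involution by metis

lemma compl_bot: "compl bot = top"
  using le_compl_commute[of top bot] by (simp add: top_unique)

lemma compl_top: "compl top = bot"
  using compl_bot compl_involution by metis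

text \<open>
  Strictness allows \<open>L(y, compl y)\<close> to be replaced by \<open>L(z, compl z)\<close>, which is below \<open>z\<close>.
  If \<open>y\<close> is \<open>bot\<close> or \<open>top\<close>, where strictness does not apply, one of \<open>y\<close> and
  \<open>compl y\<close> is \<open>bot\<close>.
\<close>

lemma below_compl_pair_le:
  assumes "z \<noteq> bot" and "w \<le> y" and "w \<le> compl y"
  shows "w \<le> z"
proof -
  consider "y = bot" | "y = top" | "z = top" | "y \<in> UNIV - {bot, top}" "z \<in> UNIV - {bot, top}"
    using assms(1) by blast
  then show ?thesis
  proof cases
    case 4
    have "w \<in> Lower_cone {y, compl y}"
      using assms(2,3) by (simp add: mem_Lower_cone)
    then have "w \<in> Lower_cone {z, compl z}"
      using strict[OF 4] by simp
    then show ?thesis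
      by (simp add: mem_Lower_cone)
  qed (use assms compl_top in \<open>auto simp: bot_unique\<close>)
qed

text \<open>The order dual of the preceding lemma, transported along the antitone involution.\<close>

lemma le_above_compl_pair:
  assumes "x \<noteq> top" and "y \<le> u" and "compl y \<le> u"
  shows "x \<le> u"
proof -
  have "compl x \<noteq> bot"
    using assms(1) compl_bot compl_involution by metis
  moreover have "compl u \<le> y" "compl u \<le> compl y"
    using assms(2,3) compl_le_compl compl_involution by metis+
  ultimately have "compl u \<le> compl x"
    by (rule below_compl_pair_le)
  then show ?thesis
    using compl_le_compl compl_involution by metis
qed

lemma bot_mem_Kleene_odot: "bot \<in> Kleene_odot compl x y"
  by (simp add: Kleene_odot_def mem_Lower_cone)

text \<open>
  Since \<open>bot\<close> occurs among the factors, one term of the intersection is already \<open>{bot}\<close>, and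
  no term omits \<open>bot\<close>.
\<close>

lemma set_extension_Kleene_odot:
  assumes "bot \<in> A" and "B \<noteq> {}"
  shows "set_extension (Kleene_odot compl) A B = {bot}"
proof
  obtain b where "b \<in> B"
    using assms(2) by blast
  then have "set_extension (Kleene_odot compl) A B \<subseteq> Kleene_odot compl bot b"
    using assms(1) by (auto simp: set_extension_def)
  then show "set_extension (Kleene_odot compl) A B \<subseteq> {bot}"
    by (simp add: Kleene_odot_def)
  show "{bot} \<subseteq> set_extension (Kleene_odot compl) A B"
    by (simp add: set_extension_def bot_mem_Kleene_odot)
qed

lemma Kleene_odot_commute: "Kleene_odot compl x y = Kleene_odot compl y x"
  by (simp add: Kleene_odot_def le_compl_commute[of x y] insert_commute)

lemma set_extension_Kleene_odot_commute:
  "set_extension (Kleene_odot compl) A B = set_extension (Kleene_odot compl) B A"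
  unfolding set_extension_def using Kleene_odot_commute by blast

lemma Kleene_odot_top: "Kleene_odot compl x top = Lower_cone {x}"
  by (auto simp: Kleene_odot_def mem_Lower_cone compl_top bot_unique)

end

context strict_Kleene_poset
begin

text \<open>
  Residuation in the case that neither definition treats separately. From left to right,
  distribute \<open>x\<close> over \<open>U(compl y, y)\<close>, which lies above \<open>x\<close>, as \<open>x = top\<close> would
  give \<open>y \<le> z\<close>. From right to left, distribute \<open>y\<close> over \<open>U(compl y, z)\<close> and use
  that \<open>L(compl y, y)\<close> lies below \<open>z\<close>, as \<open>z = bot\<close> would give \<open>x \<le> compl y\<close>.
\<close>

lemma Lower_cone_le_iff_le_Upper_cone:
  assumes "\<not> x \<le> compl y" and "\<not> y \<le> z"
  shows "Lower_cone {x, y} *<= z \<longleftrightarrow> x <=* Upper_cone {compl y, z}"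
proof
  assume below: "Lower_cone {x, y} *<= z"
  have meet: "w \<le> z" if "w \<le> x" "w \<le> y" for w
    using below that by (simp add: setle_def mem_Lower_cone)
  have "x \<noteq> top"
    using meet[of y] assms(2) by auto
  have "x \<le> u" if "compl y \<le> u" "z \<le> u" for u
  proof (rule distributive_poset_le[OF distributive, of "compl y" y x x])
    show "x \<le> v" if "compl y \<le> v" "y \<le> v" for v
      using le_above_compl_pair \<open>x \<noteq> top\<close> that by blast
    show "v \<le> u" if "v \<le> compl y" for v
      using that \<open>compl y \<le> u\<close> by (rule order_trans)
    show "v \<le> u" if "v \<le> y" "v \<le> x" for v
      using meet[OF that(2,1)] \<open>z \<le> u\<close> by (rule order_trans)
  qed simp
  then show "x <=* Upper_cone {compl y, z}"
    by (simp add: setge_def mem_Upper_cone)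
next
  assume above: "x <=* Upper_cone {compl y, z}"
  have join: "x \<le> v" if "compl y \<le> v" "z \<le> v" for v
    using above that by (simp add: setge_def mem_Upper_cone)
  have "z \<noteq> bot"
    using join[of "compl y"] assms(1) by auto
  have "w \<le> z" if "w \<le> x" "w \<le> y" for w
  proof (rule distributive_poset_le[OF distributive, of "compl y" z w y])
    show "w \<le> v" if "compl y \<le> v" "z \<le> v" for v
      using \<open>w \<le> x\<close> join[OF that] by (rule order_trans)
    show "v \<le> z" if "v \<le> compl y" "v \<le> y" for v
      using below_compl_pair_le \<open>z \<noteq> bot\<close> that by blast
  qed (use \<open>w \<le> y\<close> in simp_all)
  then show "Lower_cone {x, y} *<= z"
    by (simp add: setle_def mem_Lower_cone)
qed

lemma Kleene_adjointness: "Kleene_odot compl x y *<= z \<longleftrightarrow> x <=* Kleene_arrow compl y z"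
proof -
  consider "x \<le> compl y" | "y \<le> z" | "\<not> x \<le> compl y" "\<not> y \<le> z"
    by blast
  then show ?thesis
  proof cases
    case 1
    then have "Kleene_odot compl x y *<= z"
      by (simp add: Kleene_odot_def setle_def)
    moreover have "x <=* Kleene_arrow compl y z"
      using 1 by (auto simp: Kleene_arrow_def setge_def mem_Upper_cone intro: order_trans)
    ultimately show ?thesis
      by simp
  next
    case 2
    then have "Kleene_odot compl x y *<= z"
      by (auto simp: Kleene_odot_def setle_def mem_Lower_cone intro: order_trans)
    moreover have "x <=* Kleene_arrow compl y z"
      using 2 by (simp add: Kleene_arrow_def setge_def)
    ultimately show ?thesis
      by simp
  next
    case 3
    then show ?thesis
      using Lower_cone_le_iff_le_Upper_cone by (simp add: Kleene_odot_def Kleene_arrow_def)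
  qed
qed

end

theorem theorem5p2:
  fixes compl :: "'a::{order_bot, order_top} \<Rightarrow> 'a"
  assumes "strict_Kleene_poset compl"
    and "\<And>x y :: 'a. x \<in> UNIV - {bot} \<Longrightarrow> y \<in> UNIV - {bot} \<Longrightarrow> Lower_cone {x, y} \<noteq> {bot}"
  shows "Kleene_residuated_poset compl (Kleene_odot compl) (Kleene_arrow compl)"
proof -
  interpret strict_Kleene_poset compl
    by (fact assms(1))
  show ?thesis
  proof
    fix x y z :: 'a
    show "Kleene_odot compl x y = Kleene_odot compl y x"
      by (rule Kleene_odot_commute)
    show "Kleene_odot compl x top = Lower_cone {x}"
      by (rule Kleene_odot_top)
    then show "Kleene_odot compl top x = Lower_cone {x}"
      by (simp only: Kleene_odot_commute[of top x])
    have "set_extension (Kleene_odot compl) (Kleene_odot compl x y) {z} = {bot}"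
      by (simp add: set_extension_Kleene_odot bot_mem_Kleene_odot)
    moreover have "set_extension (Kleene_odot compl) {x} (Kleene_odot compl y z) = {bot}"
      by (subst set_extension_Kleene_odot_commute)
        (simp add: set_extension_Kleene_odot bot_mem_Kleene_odot)
    ultimately show "set_extension (Kleene_odot compl) (Kleene_odot compl x y) {z} =
        set_extension (Kleene_odot compl) {x} (Kleene_odot compl y z)"
      by simp
    show "Kleene_odot compl x y *<= z \<longleftrightarrow> x <=* Kleene_arrow compl y z"
      by (rule Kleene_adjointness)
  qed
qed

end
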